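(* Let $n \geqslant 30$ and $k \geqslant 2$ be integers with $$k \leqslant \sqrt{\frac{n}{\ln n}}.$$ Then $$m_k(n) \geqslant \frac{12}{e^{26}} \left(\frac{n}{k\ln n} \right)^{1/2} \frac{2^{n-1}}{\binom{n-1}{k-1}}.$$
   Context: A hypergraph is a pair $H=(V,E)$ with $V$ a finite set of vertices and $E$ a family of subsets of $V$ (edges); it is $n$-uniform if every edge has exactly $n$ vertices. For a natural number $k$, a hypergraph has property $B_k$ if there is a 2-coloring of $V$ such that every edge contains at least $k$ vertices of each color. $m_k(n)$ denotes the minimum number of edges of an $n$-uniform hypergraph that does not have property $B_k$. *)

theory Defs
  imports Complex_Main
begin

definition hypergraph :: "'a set \<Rightarrow> 'a set set \<Rightarrow> bool" where
  "hypergraph V E \<longleftrightarrow> finite V \<and> E \<subseteq> Pow V"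

definition uniform_hypergraph :: "nat \<Rightarrow> 'a set \<Rightarrow> 'a set set \<Rightarrow> bool" where
  "uniform_hypergraph n V E \<longleftrightarrow> hypergraph V E \<and> (\<forall>e\<in>E. card e = n)"

text \<open>
  A 2-coloring of \<open>V\<close> is a Boolean function; its values outside \<open>V\<close> play no role, since every
  edge is a subset of \<open>V\<close>.
\<close>

definition property_B :: "nat \<Rightarrow> 'a set set \<Rightarrow> bool" where
  "property_B k E \<longleftrightarrow>
     (\<exists>c :: 'a \<Rightarrow> bool. \<forall>e\<in>E. k \<le> card {v\<in>e. c v} \<and> k \<le> card {v\<in>e. \<not> c v})"

text \<open>
  Vertices are taken to be natural numbers, which covers all finite hypergraphs up to isomorphism
  (see \<open>m_B_le_card\<close>). Edges form a set, so repeated edges are not counted; a repetition would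
  not affect the minimum. For \<open>k \<ge> 1\<close> the set below is nonempty and the minimum is
  attained (see \<open>m_B_attained\<close>); the convention \<open>Inf {} = 0\<close> only matters for \<open>k = 0\<close>.
\<close>

definition m_B :: "nat \<Rightarrow> nat \<Rightarrow> nat" where
  "m_B k n = Inf {card E | (V :: nat set) E. uniform_hypergraph n V E \<and> \<not> property_B k E}"

lemma m_B_le_card:
  fixes V :: "'a set"
  assumes H: "uniform_hypergraph n V E" and nB: "\<not> property_B k E"
  shows "m_B k n \<le> card E"
proof -
  have fin: "finite V" and sub: "E \<subseteq> Pow V" and un: "\<And>e. e \<in> E \<Longrightarrow> card e = n"
    using H by (auto simp: uniform_hypergraph_def hypergraph_def)
  obtain f :: "'a \<Rightarrow> nat" where f: "inj_on f V"
    using fin finite_imp_inj_to_nat_seg by blast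
  let ?E = "(`) f ` E"
  have "uniform_hypergraph n (f ` V) ?E"
    unfolding uniform_hypergraph_def hypergraph_def
  proof (intro conjI ballI)
    show "finite (f ` V)" using fin by simp
    show "?E \<subseteq> Pow (f ` V)" using sub by blast
    fix e' assume "e' \<in> ?E"
    then obtain e where e: "e \<in> E" "e' = f ` e" by blast
    have "inj_on f e" by (rule inj_on_subset[OF f]) (use e sub in blast)
    then show "card e' = n" using e un by (simp add: card_image)
  qed
  moreover have "\<not> property_B k ?E"
  proof
    assume "property_B k ?E"
    then obtain c where c: "\<And>e. e \<in> E \<Longrightarrow> k \<le> card {v \<in> f ` e. c v} \<and> k \<le> card {v \<in> f ` e. \<not> c v}"
      unfolding property_B_def by blast
    have "k \<le> card {v \<in> e. (c \<circ> f) v} \<and> k \<le> card {v \<in> e. \<not> (c \<circ> f) v}" if "e \<in> E" for e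
    proof -
      have fe: "inj_on f e" by (rule inj_on_subset[OF f]) (use that sub in blast)
      have "card {v \<in> f ` e. P v} = card {v \<in> e. P (f v)}" for P
      proof -
        have "{v \<in> f ` e. P v} = f ` {v \<in> e. P (f v)}" by auto
        moreover have "inj_on f {v \<in> e. P (f v)}" by (rule inj_on_subset[OF fe]) blast
        ultimately show ?thesis by (simp add: card_image)
      qed
      then show ?thesis using c[OF that] by (simp add: o_def)
    qed
    then show False using nB unfolding property_B_def by blast
  qed
  moreover have "card ?E = card E"
    by (intro card_image inj_on_subset[OF inj_on_image_Pow[OF f] sub])
  ultimately have "card E \<in> {card E | (V :: nat set) E. uniform_hypergraph n V E \<and> \<not> property_B k E}"
    unfolding mem_Collect_eq by (intro exI[of _ "f ` V"] exI[of _ ?E]) simp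
  then show ?thesis unfolding m_B_def Inf_nat_def by (rule Least_le)
qed

lemma m_B_attained:
  assumes "k \<ge> 1"
  shows "\<exists>(V :: nat set) E. uniform_hypergraph n V E \<and> \<not> property_B k E \<and> card E = m_B k n"
proof -
  define V where "V = {..<2 * n}"
  define E where "E = {e. e \<subseteq> V \<and> card e = n}"
  have "finite V" and cardV: "card V = 2 * n"
    by (simp_all add: V_def)
  have "uniform_hypergraph n V E"
    unfolding uniform_hypergraph_def hypergraph_def E_def using \<open>finite V\<close> by blast
  moreover have "\<not> property_B k E"
  proof
    assume "property_B k E"
    then obtain c where c: "\<forall>e\<in>E. k \<le> card {v\<in>e. c v} \<and> k \<le> card {v\<in>e. \<not> c v}"
      unfolding property_B_def by (elim exE)
    have none: False if "e \<in> E" "{v\<in>e. c v} = {} \<or> {v\<in>e. \<not> c v} = {}" for e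
      using bspec[OF c \<open>e \<in> E\<close>] that(2) assms by (elim disjE) simp_all
    let ?A = "{v \<in> V. c v}" and ?B = "{v \<in> V. \<not> c v}"
    have "card (?A \<union> ?B) = card ?A + card ?B"
      by (rule card_Un_disjoint) (use \<open>finite V\<close> in auto)
    moreover have "?A \<union> ?B = V" by blast
    ultimately have "card ?A + card ?B = 2 * n" using cardV by simp
    then have "n \<le> card ?A \<or> n \<le> card ?B" by linarith
    then show False
    proof
      assume "n \<le> card ?A"
      then obtain e where "e \<subseteq> ?A" "card e = n" by (rule obtain_subset_with_card_n)
      then show False by (intro none[of e]) (auto simp: E_def)
    next
      assume "n \<le> card ?B"
      then obtain e where "e \<subseteq> ?B" "card e = n" by (rule obtain_subset_with_card_n)
      then show False by (intro none[of e]) (auto simp: E_def)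
    qed
  qed
  ultimately have "{card E | (V :: nat set) E. uniform_hypergraph n V E \<and> \<not> property_B k E} \<noteq> {}"
    by blast
  then have "m_B k n \<in> {card E | (V :: nat set) E. uniform_hypergraph n V E \<and> \<not> property_B k E}"
    unfolding m_B_def by (rule Inf_nat_def1)
  then obtain V' :: "nat set" and E' where
    "m_B k n = card E'" "uniform_hypergraph n V' E'" "\<not> property_B k E'"
    by (elim CollectE exE conjE)
  then show ?thesis by (intro exI[of _ V'] exI[of _ E']) simp
qed

end

theory Submission
  imports Defs "HOL-Library.FuncSet"
begin

text \<open>
  Give the vertices independent uniform weights in \<open>{0..<2n}\<close>, ties being broken by the vertex
  number, and colour red exactly the vertices that are among the last \<open>k\<close> of some edge. Every edge
  then has \<open>k\<close> red vertices. If some edge \<open>f\<close> has fewer than \<open>k\<close> others, one of its first \<open>k\<close>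
  vertices is red, so it is a pivot: a common vertex \<open>v\<close> of two edges \<open>e\<close>, \<open>f\<close> that is among the
  last \<open>k\<close> of \<open>e\<close> and among the first \<open>k\<close> of \<open>f\<close>.

  Let \<open>r = \<lceil>ln n\<rceil>\<close>. If the weight of the pivot is below \<open>n - r\<close> or at least \<open>n + r\<close>, all but
  fewer than \<open>k\<close> vertices of one edge have extreme weights, which gains a factor \<open>exp (- r)\<close> over the
  uniform colouring. Otherwise the weight lies in a window of relative length \<open>r / n\<close>, and by
  Kleitman's correlation inequality the two conditions on \<open>e\<close> and \<open>f\<close> hold together at most about as
  often as for independent edges. A pivot forces \<open>card (e \<inter> f) < 2 * k\<close>, so there are fewer than
  \<open>2 * k\<close> choices of \<open>v\<close>. The union bound over all edges and all pairs of edges gives the result.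
\<close>

section \<open>Correlation of down-sets and up-sets of a finite power set\<close>

lemma card_split_element:
  assumes "finite U" "x \<notin> U" "\<C> \<subseteq> Pow (insert x U)"
  shows "card \<C> = card {A \<in> Pow U. A \<in> \<C>} + card {A \<in> Pow U. insert x A \<in> \<C>}"
proof -
  have "\<C> = {A \<in> Pow U. A \<in> \<C>} \<union> insert x ` {A \<in> Pow U. insert x A \<in> \<C>}" (is "_ = ?P \<union> ?Q")
  proof (intro equalityI subsetI)
    fix A assume A: "A \<in> \<C>"
    show "A \<in> ?P \<union> ?Q"
    proof (cases "x \<in> A")
      case True
      then have *: "insert x (A - {x}) = A" by (rule insert_Diff)
      have "A - {x} \<subseteq> U" using A assms(3) by blast
      moreover have "insert x (A - {x}) \<in> \<C>" unfolding * by (rule A)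
      ultimately have "A - {x} \<in> {A \<in> Pow U. insert x A \<in> \<C>}" by simp
      then have "insert x (A - {x}) \<in> ?Q" by (rule imageI)
      then show ?thesis unfolding * by (rule UnI2)
    next
      case False
      then have "A \<subseteq> U" using A assms(3) by blast
      then show ?thesis using A by simp
    qed
  qed auto
  then have "card \<C> = card (?P \<union> ?Q)" by (rule arg_cong)
  also have "\<dots> = card ?P + card ?Q"
    by (rule card_Un_disjoint) (use assms(1,2) in auto)
  also have "card ?Q = card {A \<in> Pow U. insert x A \<in> \<C>}"
    by (rule card_image) (use assms(2) in \<open>auto simp: inj_on_def\<close>)
  finally show ?thesis .
qed

text \<open>Induction on the ground set: both families are split according to membership of the new
  element \<open>x\<close>. Monotonicity gives \<open>A1 \<subseteq> A0\<close> and
  \<open>B0 \<subseteq> B1\<close>, so the sizes of the halves are oppositely ordered and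
  Chebyshev's sum inequality for two terms combines the two induction hypotheses.\<close>

lemma kleitman_correlation:
  assumes "finite U" "\<A> \<subseteq> Pow U" "\<B> \<subseteq> Pow U"
    and "\<And>A B. A \<in> \<A> \<Longrightarrow> B \<subseteq> A \<Longrightarrow> B \<in> \<A>"
    and "\<And>A B. A \<in> \<B> \<Longrightarrow> A \<subseteq> B \<Longrightarrow> B \<subseteq> U \<Longrightarrow> B \<in> \<B>"
  shows "card (\<A> \<inter> \<B>) * 2 ^ card U \<le> card \<A> * card \<B>"
  using assms
proof (induction U arbitrary: \<A> \<B> rule: finite_induct)
  case empty
  then have "\<A> = {} \<or> \<A> = {{}}" "\<B> = {} \<or> \<B> = {{}}" by auto
  then show ?case by auto
next
  case (insert x U)
  define A0 A1 B0 B1 where "A0 = {A \<in> Pow U. A \<in> \<A>}" and "A1 = {A \<in> Pow U. insert x A \<in> \<A>}"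
    and "B0 = {A \<in> Pow U. A \<in> \<B>}" and "B1 = {A \<in> Pow U. insert x A \<in> \<B>}"
  note defs = A0_def A1_def B0_def B1_def
  have a: "card \<A> = card A0 + card A1" and b: "card \<B> = card B0 + card B1"
    unfolding defs by (intro card_split_element; use insert in auto)+
  have "card (\<A> \<inter> \<B>) = card {A \<in> Pow U. A \<in> \<A> \<inter> \<B>} + card {A \<in> Pow U. insert x A \<in> \<A> \<inter> \<B>}"
    by (intro card_split_element; use insert in auto)
  also have "{A \<in> Pow U. A \<in> \<A> \<inter> \<B>} = A0 \<inter> B0" by (auto simp: defs)
  also have "{A \<in> Pow U. insert x A \<in> \<A> \<inter> \<B>} = A1 \<inter> B1" by (auto simp: defs)
  finally have ab: "card (\<A> \<inter> \<B>) = card (A0 \<inter> B0) + card (A1 \<inter> B1)" .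
  have 0: "card (A0 \<inter> B0) * 2 ^ card U \<le> card A0 * card B0"
  proof (rule insert.IH)
    show "B \<in> A0" if "A \<in> A0" "B \<subseteq> A" for A B using that insert.prems(3) by (auto simp: defs)
    show "B \<in> B0" if "A \<in> B0" "A \<subseteq> B" "B \<subseteq> U" for A B
      using that insert.prems(4)[of A B] by (auto simp: defs)
  qed (auto simp: defs)
  have 1: "card (A1 \<inter> B1) * 2 ^ card U \<le> card A1 * card B1"
  proof (rule insert.IH)
    show "B \<in> A1" if "A \<in> A1" "B \<subseteq> A" for A B
      using that insert.prems(3)[of "insert x A" "insert x B"] by (auto simp: defs)
    show "B \<in> B1" if "A \<in> B1" "A \<subseteq> B" "B \<subseteq> U" for A B
      using that insert.prems(4)[of "insert x A" "insert x B"] by (auto simp: defs)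
  qed (auto simp: defs)
  have "A1 \<subseteq> A0" using insert.prems(3) by (auto simp: defs)
  then have le_a: "card A1 \<le> card A0"
    by (rule card_mono[rotated]) (use insert in \<open>auto simp: defs\<close>)
  have "B0 \<subseteq> B1"
  proof
    fix A assume "A \<in> B0"
    then show "A \<in> B1" using insert.prems(4)[of A "insert x A"] by (auto simp: defs)
  qed
  then have le_b: "card B0 \<le> card B1"
    by (rule card_mono[rotated]) (use insert in \<open>auto simp: defs\<close>)
  \<comment> \<open>With the differences named, the gap \<open>card \<A> * card \<B> - 2 * (card A0
    * card B0 + card A1 * card B1)\<close> is exactly \<open>p * q\<close>, and no truncated
    subtraction occurs.\<close>
  from le_a le_b obtain p q where pq: "card A0 = card A1 + p" "card B1 = card B0 + q"
    by (auto simp: le_iff_add)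
  have "card (\<A> \<inter> \<B>) * 2 ^ card (insert x U) \<le> 2 * (card A0 * card B0 + card A1 * card B1)"
    using 0 1 insert.hyps by (simp add: ab algebra_simps)
  also have "\<dots> \<le> card \<A> * card \<B>"
    unfolding a b pq by (simp add: algebra_simps)
  finally show ?case .
qed

section \<open>Counting subsets by the size of a trace\<close>

lemma card_subsets_less:
  assumes "finite e"
  shows "card {S \<in> Pow e. card S < k} = (\<Sum>a<k. card e choose a)"
proof -
  have "{S \<in> Pow e. card S < k} = (\<Union>a<k. {S. S \<subseteq> e \<and> card S = a})" by auto
  also have "card \<dots> = (\<Sum>a<k. card {S. S \<subseteq> e \<and> card S = a})"
    by (rule card_UN_disjoint) (use assms in auto)
  also have "\<dots> = (\<Sum>a<k. card e choose a)" by (simp add: n_subsets assms)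
  finally show ?thesis .
qed

text \<open>The trace on \<open>e\<close> and the part outside \<open>e\<close> can be chosen
  independently.\<close>

lemma card_trace_less:
  assumes "finite U" "e \<subseteq> U"
  shows "card {A \<in> Pow U. card (A \<inter> e) < k} = 2 ^ card (U - e) * (\<Sum>a<k. card e choose a)"
proof -
  have "bij_betw (\<lambda>A. (A - e, A \<inter> e)) {A \<in> Pow U. card (A \<inter> e) < k}
      (Pow (U - e) \<times> {S \<in> Pow e. card S < k})"
  proof (rule bij_betw_byWitness[where f' = "\<lambda>(P, S). P \<union> S"])
    have "(P \<union> S) \<inter> e = S" "(P \<union> S) - e = P" if "P \<subseteq> U - e" "S \<subseteq> e" for P S
      using that by auto
    then show "\<forall>x\<in>Pow (U - e) \<times> {S \<in> Pow e. card S < k}.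
        ((case x of (P, S) \<Rightarrow> P \<union> S) - e, (case x of (P, S) \<Rightarrow> P \<union> S) \<inter> e) = x"
      "(\<lambda>(P, S). P \<union> S) ` (Pow (U - e) \<times> {S \<in> Pow e. card S < k})
        \<subseteq> {A \<in> Pow U. card (A \<inter> e) < k}"
      using assms by auto
  qed auto
  then have "card {A \<in> Pow U. card (A \<inter> e) < k} = card (Pow (U - e) \<times> {S \<in> Pow e. card S < k})"
    by (rule bij_betw_same_card)
  also have "\<dots> = 2 ^ card (U - e) * card {S \<in> Pow e. card S < k}"
    using assms by (simp add: card_cartesian_product card_Pow)
  finally show ?thesis using assms by (subst (asm) card_subsets_less) (auto intro: finite_subset)
qed

text \<open>Complementation in \<open>U\<close> reduces this to
  \<open>card_trace_less\<close>.\<close>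

lemma card_cotrace_less:
  assumes "finite U" "f \<subseteq> U"
  shows "card {A \<in> Pow U. card (f - A) < k} = 2 ^ card (U - f) * (\<Sum>a<k. card f choose a)"
proof -
  have "bij_betw (\<lambda>A. U - A) {A \<in> Pow U. card (f - A) < k} {A \<in> Pow U. card (A \<inter> f) < k}"
  proof (rule bij_betw_byWitness[where f' = "\<lambda>A. U - A"])
    have "(U - A) \<inter> f = f - A" "f - (U - A) = A \<inter> f" for A using assms(2) by auto
    then show "(\<lambda>A. U - A) ` {A \<in> Pow U. card (f - A) < k} \<subseteq> {A \<in> Pow U. card (A \<inter> f) < k}"
      "(\<lambda>A. U - A) ` {A \<in> Pow U. card (A \<inter> f) < k} \<subseteq> {A \<in> Pow U. card (f - A) < k}" by auto
  qed auto
  from bij_betw_same_card[OF this] show ?thesis unfolding card_trace_less[OF assms] .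
qed

section \<open>First and last vertices of an edge, and the colouring\<close>

text \<open>Otherwise take a vertex of maximal rank outside the set: everything ranked strictly
  above it lies in the set, which has fewer than \<open>k\<close> elements, so the vertex belongs to
  the set after all. Ties in \<open>\<rho>\<close> do no harm.\<close>

lemma card_top_ge:
  fixes \<rho> :: "'a \<Rightarrow> 'b::linorder"
  assumes "finite e" "k \<le> card e"
  shows "k \<le> card {v \<in> e. card {u \<in> e. \<rho> v < \<rho> u} < k}" (is "_ \<le> card ?B")
proof (rule ccontr)
  assume neg: "\<not> k \<le> card ?B"
  have "e - ?B \<noteq> {}"
  proof
    assume "e - ?B = {}"
    then have "?B = e" by blast
    then show False using neg assms by simp
  qed
  moreover have "finite (e - ?B)" using assms by simp
  ultimately have "Max (\<rho> ` (e - ?B)) \<in> \<rho> ` (e - ?B)" by (intro Max_in) simp_all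
  then obtain v where v: "v \<in> e - ?B" "\<rho> v = Max (\<rho> ` (e - ?B))" by fastforce
  have vmax: "\<rho> u \<le> \<rho> v" if "u \<in> e - ?B" for u
    unfolding v(2) by (rule Max_ge) (use that assms in auto)
  have "{u \<in> e. \<rho> v < \<rho> u} \<subseteq> ?B"
  proof
    fix u assume u: "u \<in> {u \<in> e. \<rho> v < \<rho> u}"
    then have "\<not> \<rho> u \<le> \<rho> v" by (simp add: not_le)
    then have "u \<notin> e - ?B" using vmax by blast
    then show "u \<in> ?B" using u by blast
  qed
  then have "card {u \<in> e. \<rho> v < \<rho> u} \<le> card ?B"
    by (rule card_mono[rotated]) (use assms in auto)
  then have "v \<in> ?B" using v neg by auto
  then show False using v by blast
qed

text \<open>The colour \<open>c\<close> marks the vertices that are among the last \<open>k\<close>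
  of some edge. An edge has at least \<open>k\<close> last vertices, all marked, and at least
  \<open>k\<close> first vertices, none marked, because a marked one would be a pivot.\<close>

lemma property_B_if_no_pivot:
  fixes \<rho> :: "'a \<Rightarrow> int"
  assumes edges: "\<And>e. e \<in> E \<Longrightarrow> finite e \<and> k \<le> card e"
    and no_pivot: "\<And>e f v. e \<in> E \<Longrightarrow> f \<in> E \<Longrightarrow> v \<in> e \<inter> f \<Longrightarrow>
      card {u \<in> e. \<rho> v < \<rho> u} < k \<Longrightarrow> card {u \<in> f. \<rho> u < \<rho> v} < k \<Longrightarrow> False"
  shows "property_B k E"
proof -
  define c where "c v \<longleftrightarrow> (\<exists>e\<in>E. v \<in> e \<and> card {u \<in> e. \<rho> v < \<rho> u} < k)" for v
  have "k \<le> card {v \<in> e. c v} \<and> k \<le> card {v \<in> e. \<not> c v}" if e: "e \<in> E" for e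
  proof
    have fin: "finite e" and ke: "k \<le> card e" using edges e by auto
    have "k \<le> card {v \<in> e. card {u \<in> e. \<rho> v < \<rho> u} < k}" by (rule card_top_ge[OF fin ke])
    also have "\<dots> \<le> card {v \<in> e. c v}" by (rule card_mono) (use fin e in \<open>auto simp: c_def\<close>)
    finally show "k \<le> card {v \<in> e. c v}" .
    have "k \<le> card {v \<in> e. card {u \<in> e. \<rho> u < \<rho> v} < k}"
      \<comment> \<open>Negating the rank turns first vertices into last ones; this is why ranks are
        integers.\<close>
      using card_top_ge[OF fin ke, of "\<lambda>v. - \<rho> v"] by simp
    also have "\<dots> \<le> card {v \<in> e. \<not> c v}"
      by (rule card_mono) (use fin e no_pivot in \<open>auto simp: c_def\<close>)
    finally show "k \<le> card {v \<in> e. \<not> c v}" .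
  qed
  then show ?thesis unfolding property_B_def by blast
qed

section \<open>Weight functions that put most of an edge into a small set of weights\<close>

lemma prod_three_cases:
  fixes a b c :: "'b::comm_monoid_mult"
  assumes "finite V" "P \<subseteq> V" "Q \<subseteq> V" "P \<inter> Q = {}"
  shows "(\<Prod>u\<in>V. if u \<in> P then a else if u \<in> Q then b else c) =
    a ^ card P * b ^ card Q * c ^ (card V - card P - card Q)"
proof -
  have fin: "finite P" "finite Q" using assms by (auto intro: finite_subset)
  have "(\<Prod>u\<in>V. if u \<in> P then a else if u \<in> Q then b else c) =
      (\<Prod>u\<in>P. a) * (\<Prod>u\<in>V - P. if u \<in> Q then b else c)"
    by (subst prod.subset_diff[OF assms(2,1)]) (simp add: mult.commute)
  also have "(\<Prod>u\<in>V - P. if u \<in> Q then b else c) = (\<Prod>u\<in>Q. b) * (\<Prod>u\<in>V - P - Q. c)"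
    by (subst prod.subset_diff[of Q]) (use assms in \<open>auto simp: mult.commute\<close>)
  also have "card (V - P - Q) = card V - card P - card Q"
    using assms fin by (subst card_Diff_subset; (subst card_Diff_subset)?) auto
  ultimately show ?thesis by (simp add: mult.assoc)
qed

text \<open>Union bound over the set \<open>S\<close> of vertices of \<open>e\<close> with weight
  outside \<open>A\<close>. For fixed \<open>S\<close> the weight functions form a box
  \<open>F S\<close>, whose size is a product over the vertices.\<close>

lemma card_edge_concentrated:
  assumes "finite V" "e \<subseteq> V" "card e = n" "A \<subseteq> {..<N}" "card A = l" "2 * l \<le> N" "1 \<le> k" "k \<le> n"
  shows "card {w \<in> V \<rightarrow>\<^sub>E {..<N}. card {u \<in> e. w u \<notin> A} < k} \<le>
    (\<Sum>a<k. n choose a) * ((N - l) ^ (k - 1) * l ^ (n - k + 1) * N ^ (card V - n))"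
proof -
  define F where "F S = (\<Pi>\<^sub>E u\<in>V. if u \<in> S then {..<N} - A else if u \<in> e - S then A else {..<N})" for S
  have fe: "finite e" by (rule finite_subset[OF assms(2,1)])
  have fA: "finite A" by (rule finite_subset[OF assms(4)]) simp
  have "{w \<in> V \<rightarrow>\<^sub>E {..<N}. card {u \<in> e. w u \<notin> A} < k} \<subseteq> (\<Union>S\<in>{S \<in> Pow e. card S < k}. F S)"
  proof
    fix w assume w: "w \<in> {w \<in> V \<rightarrow>\<^sub>E {..<N}. card {u \<in> e. w u \<notin> A} < k}"
    then have "w \<in> F {u \<in> e. w u \<notin> A}" by (auto simp: F_def PiE_iff)
    moreover have "{u \<in> e. w u \<notin> A} \<in> {S \<in> Pow e. card S < k}" using w by simp
    ultimately show "w \<in> (\<Union>S\<in>{S \<in> Pow e. card S < k}. F S)" by (rule UN_I[rotated])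
  qed
  moreover have "finite (F S)" for S
    unfolding F_def by (rule finite_PiE) (use assms fA in auto)
  moreover have "card (F S) \<le> (N - l) ^ (k - 1) * l ^ (n - k + 1) * N ^ (card V - n)"
    if S: "S \<in> {S \<in> Pow e. card S < k}" for S
  proof -
    have fS: "finite S" using S fe by (auto intro: finite_subset)
    have cS: "card (e - S) = n - card S" using S fS assms(3) by (simp add: card_Diff_subset)
    have "card (F S) = (\<Prod>u\<in>V. if u \<in> S then N - l else if u \<in> e - S then l else N)"
      unfolding F_def card_PiE[OF assms(1)]
      by (rule prod.cong) (use assms fA in \<open>auto simp: card_Diff_subset\<close>)
    also have "\<dots> = (N - l) ^ card S * l ^ (n - card S) * N ^ (card V - card S - card (e - S))"
      by (subst prod_three_cases) (use assms S cS in auto)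
    also have "card V - card S - card (e - S) = card V - n" using cS S assms by auto
    \<comment> \<open>Since \<open>l \<le> N - l\<close>, trading \<open>k - 1 - card S\<close>
      factors \<open>l\<close> for \<open>N - l\<close> only increases the product and makes the
      bound independent of \<open>S\<close>.\<close>
    also have "n - card S = (k - 1 - card S) + (n - k + 1)" using S assms by auto
    also have "l ^ \<dots> = l ^ (k - 1 - card S) * l ^ (n - k + 1)" by (rule power_add)
    also have "(N - l) ^ card S * (l ^ (k - 1 - card S) * l ^ (n - k + 1)) * N ^ (card V - n)
        \<le> (N - l) ^ card S * ((N - l) ^ (k - 1 - card S) * l ^ (n - k + 1)) * N ^ (card V - n)"
      using assms by (intro mult_mono power_mono) auto
    also have "\<dots> = (N - l) ^ (card S + (k - 1 - card S)) * l ^ (n - k + 1) * N ^ (card V - n)"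
      by (simp only: power_add mult.assoc)
    also have "card S + (k - 1 - card S) = k - 1" using S by auto
    finally show ?thesis .
  qed
  ultimately have "card {w \<in> V \<rightarrow>\<^sub>E {..<N}. card {u \<in> e. w u \<notin> A} < k} \<le>
      (\<Sum>S\<in>{S \<in> Pow e. card S < k}. (N - l) ^ (k - 1) * l ^ (n - k + 1) * N ^ (card V - n))"
    using fe by (intro order_trans[OF card_mono order_trans[OF card_UN_le sum_mono]]) auto
  then show ?thesis using card_subsets_less[OF fe, of k] assms(3) by simp
qed

section \<open>Power products for weights near the middle\<close>

text \<open>Pair each \<open>a\<close> with a \<open>b\<close>: the inequality of arithmetic and
  geometric means gives \<open>a * b \<le> (1 + x / 2)\<^sup>2 \<le> exp x\<close>. The at most
  \<open>d\<close> unpaired factors \<open>b\<close> are each at most \<open>exp y\<close>.\<close>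

lemma balanced_power_bound:
  fixes a b x y :: real
  assumes "0 \<le> a" "0 \<le> b" "a + b \<le> 2 + x" "b \<le> 1 + y" "0 \<le> y" "A \<le> B" "B \<le> A + d"
  shows "a ^ A * b ^ B \<le> exp (x * A + y * d)"
proof -
  have "a * b \<le> ((a + b) / 2)\<^sup>2"
    using sum_squares_bound[of a b] by (simp add: power2_eq_square field_simps)
  also have "\<dots> \<le> (exp (x / 2))\<^sup>2"
  proof (rule power_mono)
    show "(a + b) / 2 \<le> exp (x / 2)"
      using assms(3) exp_ge_add_one_self[of "x / 2"] by argo
  qed (use assms in auto)
  also have "\<dots> = exp x" by (simp flip: exp_of_nat_mult)
  finally have "(a * b) ^ A \<le> exp x ^ A" using assms by (intro power_mono) auto
  then have 1: "(a * b) ^ A \<le> exp (x * A)" by (simp add: exp_of_nat2_mult)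
  have "b \<le> exp y" using assms(4) exp_ge_add_one_self[of y] by linarith
  then have "b ^ (B - A) \<le> exp y ^ (B - A)" using assms by (intro power_mono)
  also have "\<dots> \<le> exp y ^ d" using assms by (intro power_increasing) auto
  also have "\<dots> = exp (y * d)" by (simp add: exp_of_nat2_mult)
  finally have 2: "b ^ (B - A) \<le> exp (y * d)" .
  have "a ^ A * b ^ B = (a * b) ^ A * b ^ (B - A)"
    using assms by (simp add: power_mult_distrib flip: power_add)
  also have "\<dots> \<le> exp (x * A) * exp (y * d)" using 1 2 assms by (intro mult_mono) auto
  finally show ?thesis by (simp add: exp_add)
qed

text \<open>After division by \<open>n\<close> the two bases add up to \<open>2 + 1 / n\<close>, the
  excess coming from the weight \<open>i\<close> being counted on both sides. The smaller exponent
  is at most \<open>n\<close>, so the pairs contribute at most \<open>exp 1\<close>; each unpaired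
  factor is at most \<open>1 + r / n\<close>.\<close>

lemma middle_power_bound:
  assumes "0 < n" "r \<le> n" "n - r \<le> i" "i < n + r" "A + B \<le> 2 * n" "A \<le> B + d" "B \<le> A + d"
  shows "real ((2 * n - i) ^ B * (i + 1) ^ A) \<le> exp (1 + real r / n * d) * real n ^ (A + B)"
proof -
  define a b where "a = real (i + 1) / n" and "b = real (2 * n - i) / n"
  have ab: "0 \<le> a" "0 \<le> b" "a + b \<le> 2 + 1 / n" "b \<le> 1 + real r / n" "a \<le> 1 + real r / n"
  proof -
    have le: "real (i + 1) \<le> real n + r" "real (2 * n - i) \<le> real n + r"
      and sum: "real (i + 1) + real (2 * n - i) = 2 * n + 1"
      using assms by linarith+
    have "1 + real r / n = (real n + r) / n" using assms(1) by (simp add: add_divide_distrib)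
    then show "b \<le> 1 + real r / n" "a \<le> 1 + real r / n"
      using le by (simp_all only: a_def b_def divide_right_mono of_nat_0_le_iff)
    have "a + b = (2 * n + 1) / n" unfolding a_def b_def sum[symmetric] by (rule add_divide_distrib[symmetric])
    then show "a + b \<le> 2 + 1 / n" using assms(1) by (simp add: add_divide_distrib)
  qed (auto simp: a_def b_def)
  have "a ^ A * b ^ B \<le> exp (1 + real r / n * d)"
  proof (cases "A \<le> B")
    case True
    have "a ^ A * b ^ B \<le> exp (1 / n * A + real r / n * d)"
      using ab True assms by (intro balanced_power_bound) auto
    also have "\<dots> \<le> exp (1 + real r / n * d)" using True assms by (simp add: field_simps)
    finally show ?thesis .
  next
    case False
    have "b ^ B * a ^ A \<le> exp (1 / n * B + real r / n * d)"
      using ab False assms by (intro balanced_power_bound) auto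
    also have "\<dots> \<le> exp (1 + real r / n * d)" using False assms by (simp add: field_simps)
    finally show ?thesis by (simp add: mult.commute)
  qed
  moreover have "real ((2 * n - i) ^ B * (i + 1) ^ A) = a ^ A * b ^ B * real n ^ (A + B)"
    using assms by (simp add: a_def b_def power_divide power_add)
  ultimately show ?thesis by (simp add: mult_right_mono)
qed

section \<open>The possible sets of later vertices\<close>

text \<open>The condition on \<open>R \<inter> e\<close> is closed under subsets and the one on
  \<open>f - R\<close> under supersets, so \<open>kleitman_correlation\<close> applies. In terms of
  a random subset of \<open>U\<close>, both conditions hold with at most the product of their
  probabilities, however \<open>e\<close> and \<open>f\<close> overlap.\<close>

lemma card_late_sets:
  fixes k m :: nat and U e f :: "'a set"
  assumes "finite U" "e \<subseteq> U" "f \<subseteq> U" "card e = m" "card f = m"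
  defines "\<R> \<equiv> {R \<in> Pow U. card (R \<inter> e) < k \<and> card (f - R) < k}"
  shows "card \<R> * 4 ^ m \<le> 2 ^ card U * (\<Sum>a<k. m choose a)\<^sup>2"
proof -
  have fin: "finite e" "finite f" using assms by (auto intro: finite_subset)
  define \<A> where "\<A> = {A \<in> Pow U. card (A \<inter> e) < k}"
  define \<B> where "\<B> = {A \<in> Pow U. card (f - A) < k}"
  have "\<R> = \<A> \<inter> \<B>" by (auto simp: \<R>_def \<A>_def \<B>_def)
  moreover have "card (\<A> \<inter> \<B>) * 2 ^ card U \<le> card \<A> * card \<B>"
  proof (rule kleitman_correlation)
    fix A B assume "A \<in> \<A>" "B \<subseteq> A"
    then show "B \<in> \<A>" unfolding \<A>_def using fin card_mono[of "A \<inter> e" "B \<inter> e"] by fastforce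
  next
    fix A B assume "A \<in> \<B>" "A \<subseteq> B" "B \<subseteq> U"
    then show "B \<in> \<B>" unfolding \<B>_def using fin card_mono[of "f - A" "f - B"] by fastforce
  qed (auto simp: \<A>_def \<B>_def assms)
  moreover have "card \<A> = 2 ^ (card U - m) * (\<Sum>a<k. m choose a)"
    unfolding \<A>_def using card_trace_less[of U e k] assms fin by (simp add: card_Diff_subset)
  moreover have "card \<B> = 2 ^ (card U - m) * (\<Sum>a<k. m choose a)"
    unfolding \<B>_def using card_cotrace_less[of U f k] assms fin by (simp add: card_Diff_subset)
  ultimately have "card \<R> * 2 ^ card U \<le> (2 ^ (card U - m) * (\<Sum>a<k. m choose a))\<^sup>2"
    by (simp add: power2_eq_square)
  then have "card \<R> * 2 ^ card U * 4 ^ m \<le> (2 ^ (card U - m) * (\<Sum>a<k. m choose a))\<^sup>2 * 4 ^ m"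
    by simp
  also have "\<dots> = (2 ^ (card U - m) * 2 ^ m * (\<Sum>a<k. m choose a))\<^sup>2"
    by (simp add: power_mult_distrib power_mult[symmetric] mult.commute[of m] flip: power_even_eq)
      (simp add: power_mult)
  also have "(2::nat) ^ (card U - m) * 2 ^ m = 2 ^ card U"
    using card_mono[OF assms(1,2)] assms by (simp flip: power_add)
  finally have "2 ^ card U * (card \<R> * 4 ^ m) \<le> 2 ^ card U * (2 ^ card U * (\<Sum>a<k. m choose a)\<^sup>2)"
    by (simp add: power2_eq_square mult_ac)
  then show ?thesis by simp
qed

section \<open>Ranks with tie-breaking, pivots and the union bound\<close>

text \<open>For vertices below \<open>K\<close> this encodes the lexicographic order of pairs
  (weight, vertex number) in a single integer.\<close>

definition lex_rank :: "nat \<Rightarrow> (nat \<Rightarrow> nat) \<Rightarrow> nat \<Rightarrow> int" where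
  "lex_rank K w u = int (w u * K + u)"

lemma lex_rank_less:
  assumes "w u < w v" "u < K"
  shows "lex_rank K w u < lex_rank K w v"
proof -
  have "w u * K + u < Suc (w u) * K" using assms by simp
  also have "\<dots> \<le> w v * K" using assms by (intro mult_right_mono) auto
  finally show ?thesis unfolding lex_rank_def by linarith
qed

lemma lex_rank_inj:
  assumes "lex_rank K w u = lex_rank K w v" "u < K" "v < K"
  shows "u = v"
  using assms lex_rank_less[of w u v K] lex_rank_less[of w v u K]
  by (cases "w u" "w v" rule: linorder_cases) (auto simp: lex_rank_def)

context
  fixes n k r K :: nat and V :: "nat set"
  assumes V: "V \<subseteq> {..<K}" and k: "1 \<le> k" "2 * k \<le> n" and r: "r \<le> n"
begin

text \<open>Only the two rank conditions are recorded; membership of \<open>v\<close> in both edges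
  is required separately.\<close>

definition pivot :: "nat set \<Rightarrow> nat set \<Rightarrow> nat \<Rightarrow> (nat \<Rightarrow> nat) \<Rightarrow> bool" where
  "pivot e f v w \<longleftrightarrow> card {u \<in> e. lex_rank K w v < lex_rank K w u} < k \<and>
     card {u \<in> f. lex_rank K w u < lex_rank K w v} < k"

text \<open>A common vertex other than \<open>v\<close> is either one of the at most
  \<open>k - 1\<close> vertices of \<open>e\<close> after \<open>v\<close>, or one of the at most
  \<open>k - 1\<close> vertices of \<open>f\<close> before it. This limits the number of candidates
  for a pivot.\<close>

lemma pivot_card_Int:
  assumes "e \<subseteq> V" "f \<subseteq> V" "v \<in> e \<inter> f" "pivot e f v w"
  shows "card (e \<inter> f) < 2 * k"
proof -
  have fin: "finite e" "finite f" using assms V by (meson finite_lessThan finite_subset)+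
  let ?S = "{u \<in> e. lex_rank K w v < lex_rank K w u}" and ?T = "{u \<in> f. lex_rank K w u < lex_rank K w v}"
  have "e \<inter> f \<subseteq> insert v (?S \<union> ?T)"
  proof
    fix u assume u: "u \<in> e \<inter> f"
    then have "u < K" "v < K" using assms V by auto
    then show "u \<in> insert v (?S \<union> ?T)"
      using u lex_rank_inj[of K w u v]
      by (cases "lex_rank K w u" "lex_rank K w v" rule: linorder_cases) auto
  qed
  then have "card (e \<inter> f) \<le> card (insert v (?S \<union> ?T))" by (rule card_mono[rotated]) (use fin in auto)
  also have "\<dots> \<le> Suc (card ?S + card ?T)"
    using card_Un_le[of ?S ?T] card_insert_le_m1 fin by (simp add: card_insert_if)
  also have "\<dots> < 2 * k" using assms(4) unfolding pivot_def by linarith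
  finally show ?thesis .
qed

text \<open>Given the weight of the pivot \<open>v\<close>, the set of later vertices lies in a down-set determined by
  \<open>e\<close> and in an up-set determined by \<open>f\<close>; these are negatively correlated by
  \<open>card_late_sets\<close>.\<close>
lemma card_pivot_middle:
  assumes e: "e \<subseteq> V" "card e = n" and f: "f \<subseteq> V" "card f = n" and v: "v \<in> e \<inter> f"
    and i: "n - r \<le> i" "i < n + r"
  shows "real (card {w \<in> V \<rightarrow>\<^sub>E {..<2 * n}. w v = i \<and> pivot e f v w}) * 4 ^ (n - 1) \<le>
    exp (1 + real r / n * (2 * k)) * (\<Sum>a<k. (n - 1) choose a)\<^sup>2 * real (2 * n) ^ (card V - 1)"
proof -
  define N U s where "N = 2 * n" and "U = e \<union> f - {v}" and "s = (\<Sum>a<k. (n - 1) choose a)"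
  define \<Gamma> where "\<Gamma> = exp (1 + real r / n * (2 * k))"
  have finV: "finite V" using finite_subset[OF V] by simp
  have fin: "finite e" "finite f" "finite U"
    using e(1) f(1) finV finite_subset[of e V] finite_subset[of f V] by (auto simp: U_def)
  define \<R> where "\<R> = {R \<in> Pow U. card (R \<inter> (e - {v})) < k \<and> card (f - {v} - R) < k}"
  \<comment> \<open>The box for the late set \<open>R\<close>. The weight \<open>i\<close> is
    allowed both to later and to earlier vertices, since ties are broken by vertex number; hence the
    side lengths \<open>N - i\<close> and \<open>i + 1\<close>.\<close>
  define F where "F R = (\<Pi>\<^sub>E u\<in>V. if u \<in> {v} then {i} else if u \<in> R then {i..<N} else if u \<in> U - R then {..i} else {..<N})" for R
  have iN: "i < N" using i r by (simp add: N_def)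
  have U: "U \<subseteq> V" "v \<notin> U" "v \<in> V" using e f v by (auto simp: U_def)
  have cm: "card (e - {v}) = n - 1" "card (f - {v}) = n - 1" using v e f fin by auto
  have cU: "card U < card V" using U finV by (intro psubset_card_mono) auto
  have cU2: "card U \<le> 2 * (n - 1)"
  proof -
    have "U = (e - {v}) \<union> (f - {v})" by (auto simp: U_def)
    then show ?thesis using card_Un_le[of "e - {v}" "f - {v}"] cm by simp
  qed
  have "{w \<in> V \<rightarrow>\<^sub>E {..<N}. w v = i \<and> pivot e f v w} \<subseteq> (\<Union>R\<in>\<R>. F R)"
  proof
    fix w assume "w \<in> {w \<in> V \<rightarrow>\<^sub>E {..<N}. w v = i \<and> pivot e f v w}"
    then have w: "w \<in> V \<rightarrow>\<^sub>E {..<N}" "w v = i" "pivot e f v w" by auto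
    define R where "R = {u \<in> U. lex_rank K w v < lex_rank K w u}"
    have lt: "u < K" if "u \<in> V" for u using that V by auto
    have "R \<inter> (e - {v}) \<subseteq> {u \<in> e. lex_rank K w v < lex_rank K w u}" by (auto simp: R_def)
    from card_mono[OF _ this] have 1: "card (R \<inter> (e - {v})) < k"
      using w(3) fin by (simp add: pivot_def)
    have "f - {v} - R \<subseteq> {u \<in> f. lex_rank K w u < lex_rank K w v}"
    proof
      fix u assume u: "u \<in> f - {v} - R"
      then have "u \<in> U" "u < K" "v < K" "u \<noteq> v" using f U lt by (auto simp: U_def)
      then show "u \<in> {u \<in> f. lex_rank K w u < lex_rank K w v}"
        using u lex_rank_inj[of K w u v] by (fastforce simp: R_def)
    qed
    from card_mono[OF _ this] have 2: "card (f - {v} - R) < k"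
      using w(3) fin by (simp add: pivot_def)
    have "R \<in> \<R>" using 1 2 by (auto simp: \<R>_def R_def)
    moreover have "w \<in> F R"
    proof -
      have "i \<le> w u" if "u \<in> R" for u
        using that lex_rank_less[of w u v K] w(2) lt[of u] U by (force simp: R_def)
      moreover have "w u \<le> i" if "u \<in> U - R" for u
        using that lex_rank_less[of w v u K] w(2) lt[of v] U by (force simp: R_def)
      ultimately show ?thesis using w(1,2) by (auto simp: F_def PiE_iff)
    qed
    ultimately show "w \<in> (\<Union>R\<in>\<R>. F R)" by (rule UN_I)
  qed
  moreover have "finite (F R)" for R
    unfolding F_def by (rule finite_PiE) (use finV in auto)
  moreover have fR: "finite \<R>" using fin by (simp add: \<R>_def)
  ultimately have "card {w \<in> V \<rightarrow>\<^sub>E {..<N}. w v = i \<and> pivot e f v w} \<le> (\<Sum>R\<in>\<R>. card (F R))"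
    by (intro order_trans[OF card_mono card_UN_le]) auto
  then have "real (card {w \<in> V \<rightarrow>\<^sub>E {..<N}. w v = i \<and> pivot e f v w}) \<le> (\<Sum>R\<in>\<R>. real (card (F R)))"
    by (simp flip: of_nat_sum)
  also have "\<dots> \<le> (\<Sum>R\<in>\<R>. \<Gamma> * real n ^ card U * real N ^ (card V - 1 - card U))"
  proof (rule sum_mono)
    fix R assume R: "R \<in> \<R>"
    then have RU: "R \<subseteq> U" "finite R" using fin by (auto simp: \<R>_def intro: finite_subset)
    have cR: "card (U - R) + card R = card U"
      using RU fin by (simp add: card_Diff_subset card_mono)
    have "(\<Prod>u\<in>V. card (if u \<in> {v} then {i} else if u \<in> R then {i..<N} else if u \<in> U - R then {..i} else {..<N}))
        = (\<Prod>u\<in>V - {v}. card (if u \<in> {v} then {i} else if u \<in> R then {i..<N} else if u \<in> U - R then {..i} else {..<N}))"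
      by (simp add: prod.remove[OF finV U(3)])
    also have "\<dots> = (\<Prod>u\<in>V - {v}. if u \<in> R then N - i else if u \<in> U - R then i + 1 else N)"
      by (rule prod.cong) auto
    also have "\<dots> = (N - i) ^ card R * (i + 1) ^ card (U - R) * N ^ (card (V - {v}) - card R - card (U - R))"
      by (rule prod_three_cases) (use U RU finV in auto)
    also have "card (V - {v}) - card R - card (U - R) = card V - 1 - card U"
      using U finV cR by simp
    finally have "real (card (F R)) =
        real ((N - i) ^ card R * (i + 1) ^ card (U - R)) * real N ^ (card V - 1 - card U)"
      using finV by (simp add: F_def card_PiE)
    also have "real ((N - i) ^ card R * (i + 1) ^ card (U - R)) \<le> \<Gamma> * real n ^ (card (U - R) + card R)"
      unfolding N_def \<Gamma>_def
    proof (rule middle_power_bound)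
      \<comment> \<open>\<open>R\<close> has fewer than \<open>k\<close> elements in
        \<open>e - {v}\<close> and at most \<open>card U - (n - 1)\<close> elsewhere. As
        \<open>card U \<le> 2 * (n - 1)\<close>, it exceeds its complement by less than
        \<open>2 * k\<close>; the reverse bound follows in the same way from
        \<open>f\<close>.\<close>
      have "card R \<le> card (R \<inter> (e - {v})) + card (U - (e - {v}))"
        using RU fin by (intro order_trans[OF card_mono card_Un_le]) auto
      moreover have "card (U - R) \<le> card (f - {v} - R) + card (U - (f - {v}))"
        using RU fin by (intro order_trans[OF card_mono card_Un_le]) auto
      moreover have "card (U - (e - {v})) = card U - (n - 1)" "n - 1 \<le> card U"
        using fin cm card_mono[of U "e - {v}"] card_Diff_subset[of "e - {v}" U] by (auto simp: U_def)
      moreover have "card (U - (f - {v})) = card U - (n - 1)"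
        using fin cm card_Diff_subset[of "f - {v}" U] by (auto simp: U_def)
      moreover have "card (R \<inter> (e - {v})) < k" "card (f - {v} - R) < k" using R by (auto simp: \<R>_def)
      ultimately show "card (U - R) \<le> card R + 2 * k" "card R \<le> card (U - R) + 2 * k"
        using cR cU2 by linarith+
      show "card (U - R) + card R \<le> 2 * n" using cR cU2 by simp
    qed (use i r k in auto)
    finally show "real (card (F R)) \<le> \<Gamma> * real n ^ card U * real N ^ (card V - 1 - card U)"
      unfolding cR by (simp add: mult_right_mono)
  qed
  also have "\<dots> = real (card \<R>) * (\<Gamma> * real n ^ card U * real N ^ (card V - 1 - card U))" by simp
  finally have "real (card {w \<in> V \<rightarrow>\<^sub>E {..<N}. w v = i \<and> pivot e f v w}) * 4 ^ (n - 1)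
      \<le> (real (card \<R>) * 4 ^ (n - 1)) * (\<Gamma> * real n ^ card U * real N ^ (card V - 1 - card U))"
    by (simp add: mult_right_mono mult_ac)
  also have "\<dots> \<le> (2 ^ card U * real s ^ 2) * (\<Gamma> * real n ^ card U * real N ^ (card V - 1 - card U))"
  proof (rule mult_right_mono)
    have "card \<R> * 4 ^ (n - 1) \<le> 2 ^ card U * s\<^sup>2"
      unfolding \<R>_def s_def by (rule card_late_sets) (use cm fin in \<open>auto simp: U_def\<close>)
    from of_nat_mono[OF this, where 'a = real]
    show "real (card \<R>) * 4 ^ (n - 1) \<le> 2 ^ card U * real s ^ 2" by simp
  qed (simp add: \<Gamma>_def)
  \<comment> \<open>The factor \<open>2 ^ card U\<close> from the late sets and
    \<open>n ^ card U\<close> from the boxes recombine to \<open>N ^ card U\<close>.\<close>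
  also have "\<dots> = \<Gamma> * real s ^ 2 * (real N ^ card U * real N ^ (card V - 1 - card U))"
    by (simp add: N_def power_mult_distrib mult_ac)
  also have "real N ^ card U * real N ^ (card V - 1 - card U) = real N ^ (card V - 1)"
    using cU by (simp flip: power_add)
  finally show ?thesis by (simp add: N_def \<Gamma>_def s_def)
qed

lemma exists_pivot:
  assumes E: "\<And>e. e \<in> E \<Longrightarrow> e \<subseteq> V \<and> card e = n" and nB: "\<not> property_B k E"
  shows "\<exists>e\<in>E. \<exists>f\<in>E. \<exists>v\<in>e \<inter> f. pivot e f v w"
proof (rule ccontr)
  assume none: "\<not> ?thesis"
  have "property_B k E"
  proof (rule property_B_if_no_pivot[of E k "lex_rank K w"])
    fix e assume "e \<in> E"
    then have e: "e \<subseteq> V" "card e = n" using E by auto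
    then have "finite e" using V finite_subset[of e "{..<K}"] by auto
    then show "finite e \<and> k \<le> card e" using e k by simp
  next
    fix e f v assume "e \<in> E" "f \<in> E" "v \<in> e \<inter> f"
    moreover assume "card {u \<in> e. lex_rank K w v < lex_rank K w u} < k"
      "card {u \<in> f. lex_rank K w u < lex_rank K w v} < k"
    then have "pivot e f v w" by (simp add: pivot_def)
    ultimately show False using none by blast
  qed
  then show False using nB by simp
qed

text \<open>By \<open>exists_pivot\<close> every weight function has a pivot, and the weight of that
  pivot decides which event it is charged to. The two extreme ranges give the term linear in
  \<open>card E\<close>; the middle range gives the quadratic one, where \<open>4 * k * r\<close>
  counts fewer than \<open>2 * k\<close> vertices times \<open>2 * r\<close> weights for each
  ordered pair of edges.\<close>

lemma weighted_count:
  assumes E: "\<And>e. e \<in> E \<Longrightarrow> e \<subseteq> V \<and> card e = n" and nB: "\<not> property_B k E"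
    and ne: "n \<le> card V"
  shows "real (2 * n) ^ card V \<le>
    2 * real (card E) * (real (\<Sum>a<k. n choose a) * (real (n + r) ^ (k - 1) * real (n - r) ^ (n - k + 1) * real (2 * n) ^ (card V - n)))
    + (real (card E))\<^sup>2 * (4 * real k * real r * (exp (1 + real r / n * (2 * k)) * (real (\<Sum>a<k. (n - 1) choose a))\<^sup>2
        * real (2 * n) ^ (card V - 1) / 4 ^ (n - 1)))"
    (is "_ \<le> 2 * real (card E) * ?\<alpha> + (real (card E))\<^sup>2 * (4 * real k * real r * ?\<beta>)")
proof -
  define \<alpha> \<beta> where "\<alpha> = ?\<alpha>" and "\<beta> = ?\<beta>"
  define \<Omega> where "\<Omega> = V \<rightarrow>\<^sub>E {..<2 * n}"
  define C where "C A e = {w \<in> \<Omega>. card {u \<in> e. w u \<notin> A} < k}" for A :: "nat set" and e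
  define M where "M e f v i = {w \<in> \<Omega>. w v = i \<and> pivot e f v w}" for e f v i
  define P where "P e f = (\<Union>v\<in>e \<inter> f. \<Union>i\<in>{n - r..<n + r}. M e f v i)" for e f
  let ?L = "{..<n - r}" and ?R = "{n + r..<2 * n}"
  have finV: "finite V" using finite_subset[OF V] by simp
  have finE: "finite E" by (rule finite_subset[of _ "Pow V"]) (use E finV in auto)
  have fine: "finite e" if "e \<in> E" for e using E[OF that] finV by (auto intro: finite_subset)
  have finO: "finite \<Omega>" unfolding \<Omega>_def by (rule finite_PiE) (use finV in auto)
  have "\<Omega> \<subseteq> (\<Union>e\<in>E. C ?L e) \<union> (\<Union>e\<in>E. C ?R e) \<union> (\<Union>(e, f)\<in>E \<times> E. P e f)"
  proof
    fix w assume w: "w \<in> \<Omega>"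
    from exists_pivot[OF E nB, of w] obtain e f v where
      efv: "e \<in> E" "f \<in> E" "v \<in> e \<inter> f" "pivot e f v w" by blast
    have lt: "u < K" "w u < 2 * n" if "u \<in> V" for u using that V w by (auto simp: \<Omega>_def)
    have sub: "e \<subseteq> V" "f \<subseteq> V" using efv E by auto
    consider "w v < n - r" | "n - r \<le> w v" "w v < n + r" | "n + r \<le> w v" by linarith
    then show "w \<in> (\<Union>e\<in>E. C ?L e) \<union> (\<Union>e\<in>E. C ?R e) \<union> (\<Union>(e, f)\<in>E \<times> E. P e f)"
    proof cases
      case 1
      \<comment> \<open>A vertex of \<open>e\<close> with weight outside the low range comes after
        the pivot, so there are fewer than \<open>k\<close> of them. The high range is symmetric,
        with \<open>f\<close> in place of \<open>e\<close>.\<close>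
      have "{u \<in> e. w u \<notin> ?L} \<subseteq> {u \<in> e. lex_rank K w v < lex_rank K w u}"
      proof
        fix u assume "u \<in> {u \<in> e. w u \<notin> ?L}"
        then have "u \<in> e" "w v < w u" "v < K" using 1 efv(3) sub lt by auto
        then show "u \<in> {u \<in> e. lex_rank K w v < lex_rank K w u}" by (simp add: lex_rank_less)
      qed
      from card_mono[OF _ this] have "w \<in> C ?L e"
        using efv w fine by (simp add: C_def pivot_def)
      then show ?thesis using efv(1,2) by auto
    next
      case 2
      then have "w \<in> M e f v (w v)" using w efv by (simp add: M_def)
      moreover have "w v \<in> {n - r..<n + r}" using 2 by simp
      ultimately have "w \<in> P e f" unfolding P_def using efv(3) by (intro UN_I)
      then show ?thesis using efv(1,2) by auto
    next
      case 3
      have "{u \<in> f. w u \<notin> ?R} \<subseteq> {u \<in> f. lex_rank K w u < lex_rank K w v}"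
      proof
        fix u assume "u \<in> {u \<in> f. w u \<notin> ?R}"
        then have "u \<in> f" "w u < w v" "u < K" using 3 sub lt[of u] by auto
        then show "u \<in> {u \<in> f. lex_rank K w u < lex_rank K w v}" by (simp add: lex_rank_less)
      qed
      from card_mono[OF _ this] have "w \<in> C ?R f"
        using efv w fine by (simp add: C_def pivot_def)
      then show ?thesis using efv(1,2) by auto
    qed
  qed
  moreover have "finite ((\<Union>e\<in>E. C ?L e) \<union> (\<Union>e\<in>E. C ?R e) \<union> (\<Union>(e, f)\<in>E \<times> E. P e f))"
    by (rule finite_subset[OF _ finO]) (auto simp: C_def P_def M_def)
  ultimately have "card \<Omega> \<le> card ((\<Union>e\<in>E. C ?L e) \<union> (\<Union>e\<in>E. C ?R e) \<union> (\<Union>(e, f)\<in>E \<times> E. P e f))"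
    by (intro card_mono)
  also have "\<dots> \<le> card (\<Union>e\<in>E. C ?L e) + card (\<Union>e\<in>E. C ?R e) + card (\<Union>(e, f)\<in>E \<times> E. P e f)"
    by (intro order_trans[OF card_Un_le] add_mono card_Un_le order_refl)
  also have "\<dots> \<le> (\<Sum>e\<in>E. card (C ?L e)) + (\<Sum>e\<in>E. card (C ?R e)) + (\<Sum>(e, f)\<in>E \<times> E. card (P e f))"
    using card_UN_le[of E "C ?L"] card_UN_le[of E "C ?R"]
      card_UN_le[of "E \<times> E" "\<lambda>(e, f). P e f"] finE
    by (simp add: case_prod_unfold)
  finally have "real (card \<Omega>) \<le> (\<Sum>e\<in>E. real (card (C ?L e))) + (\<Sum>e\<in>E. real (card (C ?R e)))
      + (\<Sum>(e, f)\<in>E \<times> E. real (card (P e f)))"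
    by (simp add: case_prod_unfold flip: of_nat_sum of_nat_add)
  also have "\<dots> \<le> (\<Sum>e\<in>E. \<alpha>) + (\<Sum>e\<in>E. \<alpha>) + (\<Sum>(e, f)\<in>E \<times> E. 4 * real k * real r * \<beta>)"
  proof (intro add_mono sum_mono)
    have *: "real (card (C A e)) \<le> \<alpha>" if "e \<in> E" "A \<subseteq> {..<2 * n}" "card A = n - r" for A e
    proof -
      have "card (C A e) \<le> (\<Sum>a<k. n choose a) *
          ((2 * n - (n - r)) ^ (k - 1) * (n - r) ^ (n - k + 1) * (2 * n) ^ (card V - n))"
        unfolding C_def \<Omega>_def
        by (rule card_edge_concentrated) (use that E finV k in auto)
      also have "2 * n - (n - r) = n + r" using r by simp
      finally show ?thesis
        unfolding \<alpha>_def by (simp only: of_nat_le_iff flip: of_nat_mult of_nat_power)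
    qed
    show "real (card (C ?L e)) \<le> \<alpha>" "real (card (C ?R e)) \<le> \<alpha>" if "e \<in> E" for e
      by (rule *; use that r in auto)+
  next
    fix ef assume "ef \<in> E \<times> E"
    then obtain e f where ef: "ef = (e, f)" "e \<in> E" "f \<in> E" by auto
    have \<beta>: "0 \<le> \<beta>" by (simp add: \<beta>_def)
    have "real (card (P e f)) \<le> 4 * real k * real r * \<beta>"
    proof (cases "card (e \<inter> f) < 2 * k")
      case True
      have "card (P e f) \<le> (\<Sum>v\<in>e \<inter> f. \<Sum>i\<in>{n - r..<n + r}. card (M e f v i))"
        unfolding P_def using fine ef
        by (intro order_trans[OF card_UN_le] sum_mono card_UN_le) auto
      then have "real (card (P e f)) \<le> (\<Sum>v\<in>e \<inter> f. \<Sum>i\<in>{n - r..<n + r}. real (card (M e f v i)))"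
        by (simp flip: of_nat_sum)
      also have "\<dots> \<le> (\<Sum>v\<in>e \<inter> f. \<Sum>i\<in>{n - r..<n + r}. \<beta>)"
      proof (intro sum_mono)
        fix v i assume "v \<in> e \<inter> f" "i \<in> {n - r..<n + r}"
        then show "real (card (M e f v i)) \<le> \<beta>"
          using card_pivot_middle[of e f v i] E ef by (simp add: M_def \<Omega>_def \<beta>_def field_simps)
      qed
      also have "\<dots> = real (card (e \<inter> f) * (2 * r)) * \<beta>" using r by simp
      also have "\<dots> \<le> real (2 * k * (2 * r)) * \<beta>"
      proof (rule mult_right_mono[OF _ \<beta>])
        have "card (e \<inter> f) * (2 * r) \<le> 2 * k * (2 * r)" using True by (intro mult_right_mono) auto
        then show "real (card (e \<inter> f) * (2 * r)) \<le> real (2 * k * (2 * r))" by (rule of_nat_mono)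
      qed
      finally show ?thesis
        by simp
    next
      \<comment> \<open>The diagonal \<open>e = f\<close> falls under this case, because
        \<open>2 * k \<le> n\<close>.\<close>
      case False
      then have "pivot e f v w \<Longrightarrow> v \<in> e \<inter> f \<Longrightarrow> False" for v w
        using pivot_card_Int[of e f v w] E ef by blast
      then have "P e f = {}" by (auto simp: P_def M_def)
      then show ?thesis using \<beta> by simp
    qed
    then show "(case ef of (e, f) \<Rightarrow> real (card (P e f))) \<le> (case ef of (e, f) \<Rightarrow> 4 * real k * real r * \<beta>)"
      using ef by simp
  qed
  also have "\<dots> = 2 * real (card E) * \<alpha> + (real (card E))\<^sup>2 * (4 * real k * real r * \<beta>)"
    by (simp add: case_prod_unfold card_cartesian_product power2_eq_square)
  also have "card \<Omega> = (2 * n) ^ card V" unfolding \<Omega>_def using finV by (simp add: card_PiE)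
  finally show ?thesis unfolding \<alpha>_def \<beta>_def by simp
qed

end

section \<open>Binomial sums and normalization of the count\<close>

text \<open>In this range each binomial coefficient is at least twice its predecessor, so the sum is
  dominated by a geometric series ending in its last term.\<close>

lemma sum_binomial_le:
  assumes "3 * k \<le> m" "1 \<le> k"
  shows "(\<Sum>a<k. m choose a) \<le> 2 * (m choose (k - 1))"
  using assms
proof (induction k)
  case (Suc k)
  show ?case
  proof (cases k)
    case k: (Suc j)
    have "Suc j * (2 * (m choose j)) \<le> (m - j) * (m choose j)"
      unfolding mult.assoc[symmetric] using Suc.prems k by (intro mult_right_mono) auto
    also have "\<dots> = Suc j * (m choose Suc j)"
      by (simp only: binomial_absorb_comp binomial_absorption)
    finally have "2 * (m choose j) \<le> m choose k" unfolding k by (simp only: Suc_mult_le_cancel1)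
    moreover have "(\<Sum>a<k. m choose a) \<le> 2 * (m choose j)" using Suc.IH Suc.prems k by simp
    ultimately show ?thesis unfolding sum.lessThan_Suc by simp
  qed simp
qed simp

text \<open>Pascal's rule. It brings the sums for whole edges to the same upper index
  \<open>n - 1\<close> as those for edges without the pivot.\<close>

lemma sum_binomial_Pascal_le:
  "(\<Sum>a<k. Suc m choose a) \<le> 2 * (\<Sum>a<k. m choose a)"
proof (cases k)
  case (Suc j)
  have "(\<Sum>a<k. Suc m choose a) = (\<Sum>a<k. m choose a) + (\<Sum>a<j. m choose a)"
    unfolding Suc sum.lessThan_Suc_shift[of "\<lambda>a. Suc m choose a"]
    by (simp add: sum.distrib sum.lessThan_Suc_shift[of "\<lambda>a. m choose a"] del: sum.lessThan_Suc)
  then show ?thesis using Suc by simp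
qed simp

text \<open>With \<open>x = r / n\<close>, the bounds \<open>1 + x \<le> exp x\<close> and
  \<open>1 - x \<le> exp (- x)\<close> give the exponent \<open>2 * x * (k - 1) - r\<close>, and
  \<open>x * k \<le> 1\<close>. This is the gain \<open>exp (- r)\<close> for pivots of extreme
  weight.\<close>

lemma pow_shift_le:
  fixes n r k :: nat
  assumes "0 < n" "r \<le> n" "1 \<le> k" "k \<le> n" "r * k \<le> n"
  shows "real (n + r) ^ (k - 1) * real (n - r) ^ (n - k + 1) \<le> real n ^ n * (exp 2 * exp (- real r))"
proof -
  define x where "x = real r / n"
  have "real (n + r) = n * (1 + x)" "real (n - r) = n * (1 - x)"
    using assms by (auto simp: x_def field_simps of_nat_diff)
  then have "real (n + r) ^ (k - 1) * real (n - r) ^ (n - k + 1)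
      = real n ^ ((k - 1) + (n - k + 1)) * ((1 + x) ^ (k - 1) * (1 - x) ^ (n - k + 1))"
    by (simp only: power_mult_distrib power_add mult_ac)
  also have "(k - 1) + (n - k + 1) = n" using assms by simp
  also have "(1 + x) ^ (k - 1) * (1 - x) ^ (n - k + 1) \<le> exp x ^ (k - 1) * exp (- x) ^ (n - k + 1)"
    using assms exp_ge_add_one_self[of x] exp_ge_add_one_self[of "- x"]
    by (intro mult_mono power_mono) (auto simp: x_def)
  also have "\<dots> = exp (x * real (k - 1) + - x * real (n - k + 1))"
    by (simp only: exp_of_nat2_mult exp_add)
  also have "\<dots> \<le> exp (2 - real r)"
  proof -
    have "real r * real k \<le> n" using assms(5) by (simp flip: of_nat_mult)
    then have "x * k \<le> 1" using assms by (simp add: x_def)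
    moreover have "x * n = r" "0 \<le> x" using assms by (auto simp: x_def)
    ultimately show ?thesis using assms by (simp add: of_nat_diff algebra_simps)
  qed
  also have "\<dots> = exp 2 * exp (- real r)" by (simp flip: exp_add)
  finally show ?thesis by (simp add: mult_left_mono)
qed

text \<open>Dividing \<open>weighted_count\<close> by the number of all weight functions leaves a
  quadratic inequality in \<open>y\<close>, the edge count measured in units of
  \<open>2 ^ (n - 1) / ((n - 1) choose (k - 1))\<close>.\<close>

lemma normalized_count:
  fixes V :: "nat set" and n k r K :: nat
  assumes H: "uniform_hypergraph n V E" and nB: "\<not> property_B k E"
    and V: "V \<subseteq> {..<K}" and k: "1 \<le> k" "6 * k \<le> n" and r: "r * k \<le> n"
  defines "y \<equiv> real (card E) * real ((n - 1) choose (k - 1)) / 2 ^ (n - 1)"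
  shows "1 \<le> 4 * exp 2 * exp (- real r) * y + 8 * exp 3 * y\<^sup>2 * (real k * real r / n)"
proof -
  define m C s s' where "m = real (card E)" and "C = real ((n - 1) choose (k - 1))"
    and "s = real (\<Sum>a<k. (n - 1) choose a)" and "s' = real (\<Sum>a<k. n choose a)"
  have E: "\<And>e. e \<in> E \<Longrightarrow> e \<subseteq> V \<and> card e = n"
    using H by (auto simp: uniform_hypergraph_def hypergraph_def)
  have "finite V" using H by (simp add: uniform_hypergraph_def hypergraph_def)
  moreover have "E \<noteq> {}" using nB by (auto simp: property_B_def)
  ultimately have nV: "n \<le> card V" using E card_mono by (metis ex_in_conv)
  have n: "0 < n" using k by simp
  have rn: "r \<le> n" using r k by (metis le_trans mult_le_mono2 nat_mult_1_right)
  have "3 * k \<le> n - 1" using k by simp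
  from sum_binomial_le[OF this k(1)] have sum_le: "(\<Sum>a<k. (n - 1) choose a) \<le> 2 * ((n - 1) choose (k - 1))" .
  then have s: "s \<le> 2 * C" unfolding s_def C_def by linarith
  have "(\<Sum>a<k. n choose a) \<le> 2 * (\<Sum>a<k. (n - 1) choose a)"
    using sum_binomial_Pascal_le[of "n - 1" k] n by simp
  with sum_le have s': "s' \<le> 4 * C" unfolding s'_def C_def by linarith
  have pos: "0 \<le> m" "0 \<le> C" "0 \<le> s" "0 \<le> s'" by (simp_all add: m_def C_def s_def s'_def sum_nonneg)
  have "real r * real k \<le> n" using r by (simp flip: of_nat_mult)
  then have rk: "real r / n * (2 * k) \<le> 2" using n by (simp add: field_simps)
  define T where "T = real (2 * n) ^ card V"
  have T: "0 < T" using n by (simp add: T_def)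
  have T1: "real (2 * n) ^ (card V - 1) = T / (2 * n)"
    using n nV unfolding T_def by (cases "card V") simp_all
  have Tn: "real n ^ n * real (2 * n) ^ (card V - n) = T / 2 ^ n"
  proof -
    have "T = real (2 * n) ^ n * real (2 * n) ^ (card V - n)"
      unfolding T_def power_add[symmetric] using nV by simp
    then show ?thesis by (simp add: power_mult_distrib)
  qed
  have "T \<le> 2 * m * (s' * (real (n + r) ^ (k - 1) * real (n - r) ^ (n - k + 1) * real (2 * n) ^ (card V - n)))
      + m\<^sup>2 * (4 * real k * real r * (exp (1 + real r / n * (2 * k)) * s\<^sup>2 * real (2 * n) ^ (card V - 1) / 4 ^ (n - 1)))"
    unfolding T_def m_def s_def s'_def
    by (intro weighted_count[OF V k(1)] E nB nV rn) (use k in auto)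
  \<comment> \<open>Both binomial sums are replaced by multiples of \<open>C\<close>, and
    \<open>r * k \<le> n\<close> bounds the exponent \<open>1 + r / n * (2 * k)\<close> by
    3.\<close>
  also have "\<dots> \<le> 2 * m * (4 * C * (real n ^ n * (exp 2 * exp (- real r)) * real (2 * n) ^ (card V - n)))
      + m\<^sup>2 * (4 * real k * real r * (exp 3 * (2 * C)\<^sup>2 * real (2 * n) ^ (card V - 1) / 4 ^ (n - 1)))"
    by (intro add_mono mult_left_mono mult_mono divide_right_mono power_mono order_refl pow_shift_le)
      (use pos s s' rk n rn k r in auto)
  also have "\<dots> = T * (8 * m * C * exp 2 * exp (- real r) / 2 ^ n + 8 * exp 3 * m\<^sup>2 * C\<^sup>2 * real k * real r / n / 4 ^ (n - 1))"
  proof -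
    have "2 * m * (4 * C * (real n ^ n * (exp 2 * exp (- real r)) * real (2 * n) ^ (card V - n)))
        = 8 * m * C * exp 2 * exp (- real r) * (real n ^ n * real (2 * n) ^ (card V - n))" by simp
    then show ?thesis unfolding Tn T1 using n by (simp add: field_simps power2_eq_square)
  qed
  also have "8 * m * C * exp 2 * exp (- real r) / 2 ^ n = 4 * exp 2 * exp (- real r) * y"
    using n by (cases n) (simp_all add: y_def m_def C_def)
  also have "8 * exp 3 * m\<^sup>2 * C\<^sup>2 * real k * real r / n / 4 ^ (n - 1) = 8 * exp 3 * y\<^sup>2 * (real k * real r / n)"
  proof -
    have "(2 ^ (n - 1))\<^sup>2 = (4::real) ^ (n - 1)" by (simp flip: power_mult power_mult_distrib add: power2_eq_square)
    then have "y\<^sup>2 = m\<^sup>2 * C\<^sup>2 / 4 ^ (n - 1)"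
      by (simp add: y_def m_def C_def power_divide power_mult_distrib)
    then show ?thesis by (simp add: mult_ac)
  qed
  finally have "T * 1 \<le> T * (4 * exp 2 * exp (- real r) * y + 8 * exp 3 * y\<^sup>2 * (real k * real r / n))" by simp
  then show ?thesis using T by (simp only: mult_le_cancel_left_pos)
qed

section \<open>Choice of the window and numerical constants\<close>

theorem theorem1:
  fixes n k :: nat
  assumes "n \<ge> 30" and "k \<ge> 2"
    and "real k \<le> sqrt (real n / ln (real n))"
  shows "real (m_B k n) \<ge>
    12 / exp 26 * (real n / (real k * ln (real n))) powr (1/2) *
      (2 ^ (n - 1) / real ((n - 1) choose (k - 1)))"
proof (rule ccontr)
  assume neg: "\<not> ?thesis"
  obtain V :: "nat set" and E where H: "uniform_hypergraph n V E" "\<not> property_B k E"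
    and m: "card E = m_B k n"
    using m_B_attained[of k n] assms(2) by auto
  have "finite V" using H by (simp add: uniform_hypergraph_def hypergraph_def)
  then obtain K where K: "V \<subseteq> {..<K}" unfolding finite_nat_set_iff_bounded by (auto simp: subset_iff)
  define L c g C where "L = ln (real n)" and "c = (12 / exp 26 :: real)"
    and "g = sqrt (real n / (real k * L))" and "C = real ((n - 1) choose (k - 1))"
  define r where "r = nat \<lceil>L\<rceil>"
  define y where "y = real (card E) * C / 2 ^ (n - 1)"
  \<comment> \<open>The lower bound on \<open>n\<close> enters here:
    \<open>exp 3 \<le> 27 \<le> n\<close> gives \<open>L \<ge> 3\<close>, which later yields
    \<open>6 * k \<le> n\<close>.\<close>
  have "exp 3 = (exp 1 :: real) ^ 3" by (simp flip: exp_of_nat_mult)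
  also have "\<dots> \<le> 3 ^ 3" by (intro power_mono exp_le) simp
  finally have "exp 3 \<le> real n" using assms(1) by simp
  then have L: "3 \<le> L" unfolding L_def using assms(1) by (simp add: ln_ge_iff)
  have "(real k)\<^sup>2 \<le> (sqrt (real n / L))\<^sup>2" using assms(3) unfolding L_def by (intro power_mono) auto
  also have "\<dots> = real n / L" using L by simp
  finally have k2L: "real k * (real k * L) \<le> n" using L by (simp add: field_simps power2_eq_square)
  \<comment> \<open>The factor 2 gained from \<open>k \<ge> 2\<close> pays for rounding
    \<open>L\<close> up to \<open>r \<le> 2 * L\<close>.\<close>
  have "2 * (real k * L) \<le> real k * (real k * L)" using assms(2) L by (intro mult_right_mono) auto
  with k2L have kL: "2 * (real k * L) \<le> n" by simp
  have "6 * real k \<le> 2 * (real k * L)" using L mult_left_mono[of 3 L "real k"] by linarith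
  with kL have k6: "6 * k \<le> n" by linarith
  have rL: "L \<le> r" "r \<le> 2 * L" using L unfolding r_def by linarith+
  have "real r * real k \<le> 2 * L * real k" using rL by (intro mult_right_mono) auto
  with kL have "real (r * k) \<le> real n" by (simp add: mult_ac)
  then have rk: "r * k \<le> n" by (simp only: of_nat_le_iff)
  have C: "0 < C" unfolding C_def using k6 assms by simp
  have c: "0 < c" by (simp add: c_def)
  have g: "0 \<le> g" "g\<^sup>2 = real n / (real k * L)" using L by (simp_all add: g_def)
  have "real (card E) < c * g * (2 ^ (n - 1) / C)"
    using neg L unfolding m c_def g_def C_def L_def by (simp add: powr_half_sqrt)
  then have "y < c * g" using C unfolding y_def by (simp add: field_simps)
  then have y: "0 \<le> y" "y \<le> c * g" using C by (simp_all add: y_def)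
  have "1 \<le> 4 * exp 2 * exp (- real r) * y + 8 * exp 3 * y\<^sup>2 * (real k * real r / n)"
    unfolding y_def C_def using normalized_count[OF H K _ k6 rk] assms by simp
  \<comment> \<open>In the linear term \<open>exp (- r) \<le> 1 / n\<close> outweighs the crude
    bound \<open>g \<le> n\<close>. In the quadratic term \<open>g\<^sup>2\<close> cancels
    \<open>k * L / n\<close>, which is what fixes the order of magnitude of
    \<open>g\<close>.\<close>
  also have "\<dots> \<le> 4 * exp 2 * c + 8 * exp 3 * (2 * c\<^sup>2)"
  proof (rule add_mono)
    have "exp (- real r) \<le> exp (- L)" using rL by simp
    also have "\<dots> = 1 / n" using assms(1) by (simp add: L_def exp_minus field_simps)
    finally have "exp (- real r) * y \<le> 1 / n * (c * g)" using y by (intro mult_mono) auto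
    also have "g\<^sup>2 \<le> (real n)\<^sup>2"
    proof -
      have "real n / (real k * L) \<le> real n / 1"
        using L assms mult_mono[of 1 "real k" 1 L] by (intro divide_left_mono) auto
      also have "\<dots> \<le> (real n)\<^sup>2" using assms(1) by (simp add: power2_eq_square)
      finally show ?thesis unfolding g .
    qed
    then have "g \<le> n" by (rule power2_le_imp_le) simp
    then have "1 / n * (c * g) \<le> c" using c assms(1) by (simp add: field_simps)
    finally show "4 * exp 2 * exp (- real r) * y \<le> 4 * exp 2 * c" by simp
    have "y\<^sup>2 \<le> c\<^sup>2 * (real n / (real k * L))"
      using power_mono[OF y(2,1), of 2] by (simp add: power_mult_distrib g)
    then have "y\<^sup>2 * (real k * real r / n) \<le> c\<^sup>2 * (real n / (real k * L)) * (real k * (2 * L) / n)"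
      using rL L by (intro mult_mono divide_right_mono mult_left_mono) auto
    also have "\<dots> = 2 * c\<^sup>2" using L assms by simp
    finally show "8 * exp 3 * y\<^sup>2 * (real k * real r / n) \<le> 8 * exp 3 * (2 * c\<^sup>2)"
      unfolding mult.assoc[of "8 * exp 3"] by (rule mult_left_mono) simp
  qed
  also have "\<dots> < 1"
  proof -
    \<comment> \<open>The bound \<open>2 \<le> exp 1\<close> suffices:
      \<open>12 \<le> 2 ^ 4 \<le> exp 4\<close> turns \<open>c\<close> into at most
      \<open>exp (- 22)\<close>, and both terms become tiny.\<close>
    have "(2::real) \<le> exp 1" using exp_ge_add_one_self[of 1] by simp
    then have p: "(2::real) ^ j \<le> exp (real j)" for j
      using power_mono[of 2 "exp 1 :: real" j] by (simp add: exp_of_nat_mult[of j 1, symmetric])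
    have "c * exp 22 = 12 / exp 4"
      unfolding c_def by (simp add: field_simps flip: exp_add)
    also have "\<dots> \<le> 1" using p[of 4] by (simp add: field_simps)
    finally have cle: "c \<le> exp (- 22)" by (simp add: exp_minus field_simps)
    have "exp 2 * c \<le> exp 2 * exp (- 22)" using cle by simp
    also have "\<dots> = exp (- 20)" by (simp flip: exp_add)
    also have "\<dots> \<le> 1 / 2 ^ 20" using p[of 20] by (simp add: exp_minus field_simps)
    finally have 1: "exp 2 * c \<le> 1 / 2 ^ 20" .
    have "exp 3 * c\<^sup>2 \<le> exp 3 * (exp (- 22))\<^sup>2" using cle c by (intro mult_left_mono power_mono) auto
    also have "\<dots> = exp (- 41)" by (simp add: power2_eq_square flip: exp_add)
    also have "\<dots> \<le> 1 / 2 ^ 41" using p[of 41] by (simp add: exp_minus field_simps)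
    finally have 2: "exp 3 * c\<^sup>2 \<le> 1 / 2 ^ 41" .
    have "4 * exp 2 * c + 8 * exp 3 * (2 * c\<^sup>2) = 4 * (exp 2 * c) + 16 * (exp 3 * c\<^sup>2)" by simp
    also have "\<dots> < 1" using 1 2 by simp
    finally show ?thesis .
  qed
  finally show False by simp
qed

end
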